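(* Let $J$ ($SL(N,\mathbb{C})$-valued) and $X$ ($sl(N,\mathbb{C})$-valued) be solutions of the SDYM3 equation $D_{\bar y}(J^{-1}J_y)+D_z(J^{-1}J_z)=0$ and the PSDYM3 equation $X_{y\bar y}+X_{zz}+[X_z,X_{\bar y}]=0$, respectively, connected by $J^{-1}J_y=X_z$, $J^{-1}J_z=-X_{\bar y}$. The map $$I:\ \Phi=I\{Q\}=\hat R\,J^{-1}Q,\qquad\text{equivalently}\qquad \Delta X=I\{\Delta J\}=\hat R\,J^{-1}\Delta J,$$ from the symmetry characteristics $Q=\Delta J$ of SDYM3 to the symmetry characteristics $\Phi=\Delta X$ of PSDYM3, is an isomorphism between the symmetry Lie algebras of SDYM3 and PSDYM3. In particular, if $Q^{(l)}=\Delta^{(l)}J$ and $\Phi^{(l)}=\Delta^{(l)}X=I\{Q^{(l)}\}$ for $l=i,j$, then $$[\Delta^{(i)},\Delta^{(j)}]X=I\big\{[\Delta^{(i)},\Delta^{(j)}]J\big\}=\hat R\,J^{-1}[\Delta^{(i)},\Delta^{(j)}]J.$$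
   Context: The independent variables are $y,z,\bar y$ (complex, treated as three independent variables). $D_y,D_z,D_{\bar y}$ are the total derivatives, also denoted by subscripts; they commute and satisfy the Leibniz rule. $[\cdot,\cdot]$ applied to matrices is the matrix commutator, and applied to operators it is the operator commutator. An operator acts on the entire product to its right. The covariant derivative operators, acting on matrix-valued functions, are $$\hat A_y=D_y+[J^{-1}J_y,\ \cdot\ ]=D_y+[X_z,\ \cdot\ ],\qquad \hat A_z=D_z+[J^{-1}J_z,\ \cdot\ ]=D_z-[X_{\bar y},\ \cdot\ ],$$ and $\hat R=D_z^{-1}\hat A_y$, where $D_z^{-1}$ is a linear operator of formal integration in $z$, with $D_zD_z^{-1}=\mathrm{id}$. Symmetry characteristics (matrix-valued, possibly nonlocal in $J$, $X$): $Q$ is an SDYM3 characteristic if $(D_{\bar y}\hat A_y+D_z\hat A_z)(J^{-1}Q)=0$ on solutions. $\Phi$ is a PSDYM3 characteristic if $(D_{\bar y}\hat A_y+D_z\hat A_z)\Phi=0$ on solutions. These are the linearizations of the two equations. Fréchet derivative: to a pair $(Q,\Phi)$ with $\Phi=I\{Q\}$ corresponds the linear operator $\Delta$ with $\Delta J=Q$, $\Delta X=\Phi$, which annihilates functions of $y,z,\bar y$ alone, satisfies the Leibniz rule, and commutes with all total derivatives and their powers (including $D_z^{-1}$). In particular $\Delta(J^{-1})=-J^{-1}(\Delta J)J^{-1}$. Lie brackets: $[\Delta^{(i)},\Delta^{(j)}]J=\Delta^{(i)}Q^{(j)}-\Delta^{(j)}Q^{(i)}$ and $[\Delta^{(i)},\Delta^{(j)}]X=\Delta^{(i)}\Phi^{(j)}-\Delta^{(j)}\Phi^{(i)}$.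 These are again symmetry characteristics of SDYM3 and PSDYM3, respectively, and make the sets of characteristics Lie algebras. Normalization convention: $\Phi=\hat RJ^{-1}Q$ denotes the solution $\Phi$ of the consistent system $\hat A_y(J^{-1}Q)=\Phi_z$, $\hat A_z(J^{-1}Q)=-\Phi_{\bar y}$. For given $Q$ the solution $\Phi$, and for given $\Phi$ the solution $Q$, are determined only up to additive terms solving the corresponding homogeneous equations. Such additive terms are ignored, so that in particular $Q=0$ corresponds to $\Phi=0$, and the system establishes a one-to-one linear correspondence between the SDYM3 and PSDYM3 characteristics. $I$ denotes this correspondence. *)

theory Defs
  imports "HOL-Analysis.Analysis"
begin

locale lie_algebra = vector_space scale
  for scale :: "'k::field \<Rightarrow> 'v::ab_group_add \<Rightarrow> 'v" +
  fixes L :: "'v set" and bracket :: "'v \<Rightarrow> 'v \<Rightarrow> 'v"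
  assumes carrier_subspace: "subspace L"
    and bracket_closed: "\<lbrakk>u \<in> L; v \<in> L\<rbrakk> \<Longrightarrow> bracket u v \<in> L"
    and bracket_add_left: "\<lbrakk>u \<in> L; v \<in> L; w \<in> L\<rbrakk> \<Longrightarrow> bracket (u + v) w = bracket u w + bracket v w"
    and bracket_add_right: "\<lbrakk>u \<in> L; v \<in> L; w \<in> L\<rbrakk> \<Longrightarrow> bracket u (v + w) = bracket u v + bracket u w"
    and bracket_scale_left: "\<lbrakk>u \<in> L; v \<in> L\<rbrakk> \<Longrightarrow> bracket (scale c u) v = scale c (bracket u v)"
    and bracket_scale_right: "\<lbrakk>u \<in> L; v \<in> L\<rbrakk> \<Longrightarrow> bracket u (scale c v) = scale c (bracket u v)"
    and bracket_alternating: "u \<in> L \<Longrightarrow> bracket u u = 0"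
    and jacobi: "\<lbrakk>u \<in> L; v \<in> L; w \<in> L\<rbrakk> \<Longrightarrow>
      bracket u (bracket v w) + bracket v (bracket w u) + bracket w (bracket u v) = 0"

definition lie_algebra_iso ::
  "('k::field \<Rightarrow> 'v::ab_group_add \<Rightarrow> 'v) \<Rightarrow> 'v set \<Rightarrow> ('v \<Rightarrow> 'v \<Rightarrow> 'v) \<Rightarrow>
   ('k \<Rightarrow> 'w::ab_group_add \<Rightarrow> 'w) \<Rightarrow> 'w set \<Rightarrow> ('w \<Rightarrow> 'w \<Rightarrow> 'w) \<Rightarrow> ('v \<Rightarrow> 'w) \<Rightarrow> bool"
  where "lie_algebra_iso s L br s' L' br' f \<longleftrightarrow>
    lie_algebra s L br \<and> lie_algebra s' L' br' \<and> bij_betw f L L' \<and>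
    (\<forall>u\<in>L. \<forall>v\<in>L. f (u + v) = f u + f v) \<and>
    (\<forall>c. \<forall>u\<in>L. f (s c u) = s' c (f u)) \<and>
    (\<forall>u\<in>L. \<forall>v\<in>L. f (br u v) = br' (f u) (f v))"

text \<open>
  The carrier type is the commutative algebra of complex-valued, possibly nonlocal functions of
  \<open>y\<close>, \<open>z\<close>, \<open>ybar\<close> and of the solution; an equality between its elements is an equality
  ``on solutions''. The suffix \<open>yb\<close> stands for the independent variable \<open>ybar\<close>, \<open>indep\<close> is the
  subalgebra of the functions of \<open>y\<close>, \<open>z\<close>, \<open>ybar\<close> alone, and \<open>Dinv_z\<close> is formal integration
  in \<open>z\<close>. All operators act on matrices entrywise, via \<^const>\<open>map_matrix\<close>.
\<close>

record 'a diff_calc =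
  cst :: "complex \<Rightarrow> 'a"
  indep :: "'a set"
  var_y :: 'a
  var_z :: 'a
  var_yb :: 'a
  D_y :: "'a \<Rightarrow> 'a"
  D_z :: "'a \<Rightarrow> 'a"
  D_yb :: "'a \<Rightarrow> 'a"
  Dinv_z :: "'a \<Rightarrow> 'a"

definition complex_linear_op :: "'a::comm_ring_1 diff_calc \<Rightarrow> ('a \<Rightarrow> 'a) \<Rightarrow> bool"
  where "complex_linear_op C T \<longleftrightarrow>
    (\<forall>a b. T (a + b) = T a + T b) \<and> (\<forall>c a. T (cst C c * a) = cst C c * T a)"

definition leibniz :: "('a::comm_ring_1 \<Rightarrow> 'a) \<Rightarrow> bool"
  where "leibniz T \<longleftrightarrow> (\<forall>a b. T (a * b) = T a * b + a * T b)"

locale diff_calculus =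
  fixes C :: "'a::comm_ring_1 diff_calc"
  assumes cst_hom: "cst C 1 = 1" "\<And>c d. cst C (c + d) = cst C c + cst C d"
      "\<And>c d. cst C (c * d) = cst C c * cst C d"
    and indep_subalgebra: "range (cst C) \<subseteq> indep C"
      "\<And>f g. \<lbrakk>f \<in> indep C; g \<in> indep C\<rbrakk> \<Longrightarrow> f + g \<in> indep C"
      "\<And>f g. \<lbrakk>f \<in> indep C; g \<in> indep C\<rbrakk> \<Longrightarrow> f * g \<in> indep C"
    and indep_vars: "var_y C \<in> indep C" "var_z C \<in> indep C" "var_yb C \<in> indep C"
    and indep_D: "\<And>f. f \<in> indep C \<Longrightarrow> D_y C f \<in> indep C \<and> D_z C f \<in> indep C \<and> D_yb C f \<in> indep C"
    and D_vars:
      "D_y C (var_y C) = 1" "D_y C (var_z C) = 0" "D_y C (var_yb C) = 0"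
      "D_z C (var_y C) = 0" "D_z C (var_z C) = 1" "D_z C (var_yb C) = 0"
      "D_yb C (var_y C) = 0" "D_yb C (var_z C) = 0" "D_yb C (var_yb C) = 1"
    and D_linear: "complex_linear_op C (D_y C)" "complex_linear_op C (D_z C)"
      "complex_linear_op C (D_yb C)"
    and D_leibniz: "leibniz (D_y C)" "leibniz (D_z C)" "leibniz (D_yb C)"
    and D_commute: "\<And>a. D_y C (D_z C a) = D_z C (D_y C a)"
      "\<And>a. D_y C (D_yb C a) = D_yb C (D_y C a)"
      "\<And>a. D_z C (D_yb C a) = D_yb C (D_z C a)"
    and Dinv_z_linear: "complex_linear_op C (Dinv_z C)"
    and D_z_Dinv_z: "\<And>a. D_z C (Dinv_z C a) = a"

definition mscale :: "'a::comm_ring_1 diff_calc \<Rightarrow> complex \<Rightarrow> 'a^'n^'n \<Rightarrow> 'a^'n^'n"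
  where "mscale C c M = map_matrix (\<lambda>a. cst C c * a) M"

definition mcomm :: "'a::comm_ring_1^'n^'n \<Rightarrow> 'a^'n^'n \<Rightarrow> 'a^'n^'n"
  where "mcomm A B = A ** B - B ** A"

definition cov :: "('a::comm_ring_1 \<Rightarrow> 'a) \<Rightarrow> 'a^'n^'n \<Rightarrow> 'a^'n^'n \<Rightarrow> 'a^'n^'n"
  where "cov D A M = map_matrix D M + mcomm A M"

definition Ahat_y :: "'a::comm_ring_1 diff_calc \<Rightarrow> 'a^'n^'n \<Rightarrow> 'a^'n^'n \<Rightarrow> 'a^'n^'n"
  where "Ahat_y C J = cov (D_y C) (matrix_inv J ** map_matrix (D_y C) J)"

definition Ahat_z :: "'a::comm_ring_1 diff_calc \<Rightarrow> 'a^'n^'n \<Rightarrow> 'a^'n^'n \<Rightarrow> 'a^'n^'n"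
  where "Ahat_z C J = cov (D_z C) (matrix_inv J ** map_matrix (D_z C) J)"

definition Rhat :: "'a::comm_ring_1 diff_calc \<Rightarrow> 'a^'n^'n \<Rightarrow> 'a^'n^'n \<Rightarrow> 'a^'n^'n"
  where "Rhat C J M = map_matrix (Dinv_z C) (Ahat_y C J M)"

definition sdym3 :: "'a::comm_ring_1 diff_calc \<Rightarrow> 'a^'n^'n \<Rightarrow> bool"
  where "sdym3 C J \<longleftrightarrow>
    map_matrix (D_yb C) (matrix_inv J ** map_matrix (D_y C) J) +
    map_matrix (D_z C) (matrix_inv J ** map_matrix (D_z C) J) = 0"

definition psdym3 :: "'a::comm_ring_1 diff_calc \<Rightarrow> 'a^'n^'n \<Rightarrow> bool"
  where "psdym3 C X \<longleftrightarrow>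
    map_matrix (D_yb C) (map_matrix (D_y C) X) + map_matrix (D_z C) (map_matrix (D_z C) X) +
    mcomm (map_matrix (D_z C) X) (map_matrix (D_yb C) X) = 0"

definition connected :: "'a::comm_ring_1 diff_calc \<Rightarrow> 'a^'n^'n \<Rightarrow> 'a^'n^'n \<Rightarrow> bool"
  where "connected C J X \<longleftrightarrow>
    matrix_inv J ** map_matrix (D_y C) J = map_matrix (D_z C) X \<and>
    matrix_inv J ** map_matrix (D_z C) J = - map_matrix (D_yb C) X"

definition sdym3_characteristic :: "'a::comm_ring_1 diff_calc \<Rightarrow> 'a^'n^'n \<Rightarrow> 'a^'n^'n \<Rightarrow> bool"
  where "sdym3_characteristic C J Q \<longleftrightarrow>
    map_matrix (D_yb C) (Ahat_y C J (matrix_inv J ** Q)) +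
    map_matrix (D_z C) (Ahat_z C J (matrix_inv J ** Q)) = 0"

text \<open>Here the covariant derivatives are written through \<open>X\<close>; they are the same operators.\<close>

definition psdym3_characteristic :: "'a::comm_ring_1 diff_calc \<Rightarrow> 'a^'n^'n \<Rightarrow> 'a^'n^'n \<Rightarrow> bool"
  where "psdym3_characteristic C X \<Phi> \<longleftrightarrow>
    map_matrix (D_yb C) (cov (D_y C) (map_matrix (D_z C) X) \<Phi>) +
    map_matrix (D_z C) (cov (D_z C) (- map_matrix (D_yb C) X) \<Phi>) = 0"

lemma Ahat_eq_cov_potential:
  assumes "connected C J X"
  shows "Ahat_y C J = cov (D_y C) (map_matrix (D_z C) X)"
    and "Ahat_z C J = cov (D_z C) (- map_matrix (D_yb C) X)"
  using assms by (simp_all add: connected_def Ahat_y_def Ahat_z_def)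

definition recursion_system ::
  "'a::comm_ring_1 diff_calc \<Rightarrow> 'a^'n^'n \<Rightarrow> 'a^'n^'n \<Rightarrow> 'a^'n^'n \<Rightarrow> bool"
  where "recursion_system C J Q \<Phi> \<longleftrightarrow>
    Ahat_y C J (matrix_inv J ** Q) = map_matrix (D_z C) \<Phi> \<and>
    Ahat_z C J (matrix_inv J ** Q) = - map_matrix (D_yb C) \<Phi>"

definition I_map :: "'a::comm_ring_1 diff_calc \<Rightarrow> 'a^'n^'n \<Rightarrow> 'a^'n^'n \<Rightarrow> 'a^'n^'n"
  where "I_map C J Q = Rhat C J (matrix_inv J ** Q)"

definition frechet_op :: "'a::comm_ring_1 diff_calc \<Rightarrow> ('a \<Rightarrow> 'a) \<Rightarrow> bool"
  where "frechet_op C \<Delta> \<longleftrightarrow>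
    complex_linear_op C \<Delta> \<and> leibniz \<Delta> \<and> (\<forall>f\<in>indep C. \<Delta> f = 0) \<and>
    (\<forall>a. \<Delta> (D_y C a) = D_y C (\<Delta> a)) \<and> (\<forall>a. \<Delta> (D_z C a) = D_z C (\<Delta> a)) \<and>
    (\<forall>a. \<Delta> (D_yb C a) = D_yb C (\<Delta> a)) \<and> (\<forall>a. \<Delta> (Dinv_z C a) = Dinv_z C (\<Delta> a))"

definition frechet_of ::
  "'a::comm_ring_1 diff_calc \<Rightarrow> 'a^'n^'n \<Rightarrow> 'a^'n^'n \<Rightarrow> 'a^'n^'n \<Rightarrow> 'a^'n^'n \<Rightarrow> ('a \<Rightarrow> 'a) \<Rightarrow> bool"
  where "frechet_of C J X Q \<Phi> \<Delta> \<longleftrightarrow>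
    frechet_op C \<Delta> \<and> map_matrix \<Delta> J = Q \<and> map_matrix \<Delta> X = \<Phi>"

definition op_comm :: "('a::comm_ring_1 \<Rightarrow> 'a) \<Rightarrow> ('a \<Rightarrow> 'a) \<Rightarrow> 'a \<Rightarrow> 'a"
  where "op_comm S T = (\<lambda>a. S (T a) - T (S a))"

text \<open>
  \<open>NQ\<close> and \<open>NP\<close> are the classes of matrix functions in which characteristics are taken once the
  solutions of the homogeneous equations are discarded (see \<open>normalized_sdym3\<close> below).
\<close>

definition sdym3_symmetries :: "'a::comm_ring_1 diff_calc \<Rightarrow> 'a^'n^'n \<Rightarrow> ('a^'n^'n) set \<Rightarrow> ('a^'n^'n) set"
  where "sdym3_symmetries C J NQ = {Q \<in> NQ. sdym3_characteristic C J Q}"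

definition psdym3_symmetries :: "'a::comm_ring_1 diff_calc \<Rightarrow> 'a^'n^'n \<Rightarrow> ('a^'n^'n) set \<Rightarrow> ('a^'n^'n) set"
  where "psdym3_symmetries C X NP = {\<Phi> \<in> NP. psdym3_characteristic C X \<Phi>}"

definition sdym3_bracket ::
  "'a::comm_ring_1 diff_calc \<Rightarrow> 'a^'n^'n \<Rightarrow> 'a^'n^'n \<Rightarrow> 'a^'n^'n \<Rightarrow> 'a^'n^'n \<Rightarrow> 'a^'n^'n"
  where "sdym3_bracket C J X Q Q' =
    map_matrix (THE \<Delta>. frechet_of C J X Q (I_map C J Q) \<Delta>) Q' -
    map_matrix (THE \<Delta>. frechet_of C J X Q' (I_map C J Q') \<Delta>) Q"

definition psdym3_bracket ::
  "'a::comm_ring_1 diff_calc \<Rightarrow> 'a^'n^'n \<Rightarrow> 'a^'n^'n \<Rightarrow> ('a^'n^'n) set \<Rightarrow>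
   'a^'n^'n \<Rightarrow> 'a^'n^'n \<Rightarrow> 'a^'n^'n"
  where "psdym3_bracket C J X NQ \<Phi> \<Phi>' =
    (let Iinv = inv_into (sdym3_symmetries C J NQ) (I_map C J) in
      map_matrix (THE \<Delta>. frechet_of C J X (Iinv \<Phi>) \<Phi> \<Delta>) \<Phi>' -
      map_matrix (THE \<Delta>. frechet_of C J X (Iinv \<Phi>') \<Phi>' \<Delta>) \<Phi>)"

text \<open>
  The relation \<open>recursion_system\<close> determines \<open>\<Phi>\<close> from \<open>Q\<close> and \<open>Q\<close> from \<open>\<Phi>\<close> only up to solutions of
  the homogeneous equations. Discarding these amounts to working in linear classes \<open>NQ\<close>, \<open>NP\<close> that
  contain no nonzero homogeneous solution (\<open>homogeneous_Q\<close>, \<open>homogeneous_\<Phi>\<close>) and in which the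
  consistent system is solvable, the solution \<open>\<Phi>\<close> being the one that \<open>Dinv_z\<close> picks
  (\<open>solvable_\<Phi>\<close>, \<open>solvable_Q\<close>). That a solution of the system is again a characteristic, and that
  \<open>I_map\<close> is linear, is not assumed. Tracelessness of \<open>J\<^sup>-\<^sup>1 Q\<close> and of \<open>\<Phi>\<close> follows from
  \<open>frechet_unique\<close>, by applying \<open>\<Delta>\<close> to \<open>det J = 1\<close> and \<open>trace X = 0\<close>.
\<close>

locale normalized_sdym3 = diff_calculus C
  for C :: "'a::comm_ring_1 diff_calc" +
  fixes J X :: "'a^'n^'n" and NQ NP :: "('a^'n^'n) set"
  assumes J_SL: "invertible J" "det J = 1"
    and X_sl: "trace X = 0"
    and J_solution: "sdym3 C J"
    and X_solution: "psdym3 C X"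
    and J_X_connected: "connected C J X"
    and NQ_subspace: "module.subspace (mscale C) NQ"
    and NP_subspace: "module.subspace (mscale C) NP"
    and homogeneous_Q: "\<And>Q. \<lbrakk>Q \<in> NQ; recursion_system C J Q 0\<rbrakk> \<Longrightarrow> Q = 0"
    and homogeneous_\<Phi>: "\<And>\<Phi>. \<lbrakk>\<Phi> \<in> NP; recursion_system C J 0 \<Phi>\<rbrakk> \<Longrightarrow> \<Phi> = 0"
    and solvable_\<Phi>: "\<And>Q. \<lbrakk>Q \<in> NQ; sdym3_characteristic C J Q\<rbrakk> \<Longrightarrow>
        Rhat C J (matrix_inv J ** Q) \<in> NP \<and> recursion_system C J Q (Rhat C J (matrix_inv J ** Q))"
    and solvable_Q: "\<And>\<Phi>. \<lbrakk>\<Phi> \<in> NP; psdym3_characteristic C X \<Phi>\<rbrakk> \<Longrightarrow>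
        \<exists>Q\<in>NQ. recursion_system C J Q \<Phi>"
    and frechet_unique: "\<And>Q. Q \<in> sdym3_symmetries C J NQ \<Longrightarrow>
        \<exists>!\<Delta>. frechet_of C J X Q (I_map C J Q) \<Delta>"
    and bracket_normalized: "\<And>Q Q' \<Delta> \<Delta>'.
        \<lbrakk>Q \<in> sdym3_symmetries C J NQ; frechet_of C J X Q (I_map C J Q) \<Delta>;
         Q' \<in> sdym3_symmetries C J NQ; frechet_of C J X Q' (I_map C J Q') \<Delta>'\<rbrakk> \<Longrightarrow>
        map_matrix (op_comm \<Delta> \<Delta>') J \<in> NQ"

end

theory Submission
  imports Defs
begin

text \<open>
  Linearizing the connecting relations \<open>J\<^sup>-\<^sup>1 J\<^sub>y = X\<^sub>z\<close>, \<open>J\<^sup>-\<^sup>1 J\<^sub>z = - X\<^bsub>yb\<^esub>\<close> along any derivation \<open>\<Delta>\<close>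
  commuting with the total derivatives gives exactly the recursion system for the pair
  \<open>(\<Delta> J, \<Delta> X)\<close>. The commutator \<open>[\<Delta>, \<Delta>']\<close> is again such a derivation, so
  \<open>([\<Delta>, \<Delta>'] J, [\<Delta>, \<Delta>'] X)\<close> solves the system; since \<open>\<Delta> X\<close> and \<open>\<Delta>' X\<close> lie in the range of
  \<open>Dinv_z\<close>, so does \<open>[\<Delta>, \<Delta>'] X\<close>, and therefore it is the solution selected by \<open>Rhat\<close>. Thus the
  bracket of characteristics is the commutator of their Frechet derivatives, whence the Lie
  algebra laws. That solutions \<open>\<Phi>\<close> of the system are characteristics of PSDYM3 is the flatness
  \<open>[Ahat_y, Ahat_z] = 0\<close> of the connection \<open>J\<^sup>-\<^sup>1 dJ\<close>.
\<close>

subsection \<open>Transport of Lie algebra structures\<close>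

text \<open>Every element of \<open>L'\<close> is an image under \<open>f\<close>, so each law for
  \<open>br'\<close> is the image of a law for \<open>br\<close>. The laws thus have to be checked
  only on the SDYM3 side.\<close>

lemma lie_algebra_iso_transport:
  assumes lie: "lie_algebra s L br" and vs: "vector_space s'"
    and bij: "bij_betw f L L'"
    and add: "\<And>u v. \<lbrakk>u \<in> L; v \<in> L\<rbrakk> \<Longrightarrow> f (u + v) = f u + f v"
    and scale: "\<And>c u. u \<in> L \<Longrightarrow> f (s c u) = s' c (f u)"
    and br: "\<And>u v. \<lbrakk>u \<in> L; v \<in> L\<rbrakk> \<Longrightarrow> br' (f u) (f v) = f (br u v)"
  shows "lie_algebra_iso s L br s' L' br' f"
proof -
  interpret L: lie_algebra s L br by (rule lie)
  interpret V: vector_space s' by (rule vs)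
  have L': "L' = f ` L" using bij by (auto simp: bij_betw_def)
  note closed [simp] = L.subspace_0 [OF L.carrier_subspace] L.subspace_add [OF L.carrier_subspace]
    L.subspace_scale [OF L.carrier_subspace] L.bracket_closed
  have f0: "f 0 = 0" using add [of 0 0] by simp
  have "lie_algebra s' L' br'"
  proof
    \<comment> \<open>\<open>add\<close>, \<open>scale\<close> and \<open>f0\<close> are applied
      from right to left to collect everything under a single \<open>f\<close>; the
      \<open>closed\<close> facts discharge their membership conditions.\<close>
    show "V.subspace L'"
      unfolding L' by (rule V.subspaceI) (auto simp flip: add scale f0)
  next
    fix c u v w
    assume "u \<in> L'" "v \<in> L'" "w \<in> L'"
    then obtain a b d where a: "a \<in> L" "b \<in> L" "d \<in> L" and [simp]: "u = f a" "v = f b" "w = f d"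
      unfolding L' by blast
    show "br' u (br' v w) + br' v (br' w u) + br' w (br' u v) = 0"
      using a L.jacobi [of a b d] by (simp add: br f0 flip: add)
  qed (auto simp: L' br L.bracket_add_left L.bracket_add_right L.bracket_scale_left
      L.bracket_scale_right L.bracket_alternating f0 simp flip: add scale)
  then show ?thesis
    using assms by (simp add: lie_algebra_iso_def)
qed

subsection \<open>Derivations acting on matrices\<close>

context
  fixes A B C :: "'a::comm_ring_1^'n^'n"
begin

lemma matrix_uminus_left: "(- A) ** B = - (A ** B)"
  by (simp add: matrix_matrix_mult_def vec_eq_iff sum_negf)

lemma matrix_uminus_right: "A ** (- B) = - (A ** B)"
  by (simp add: matrix_matrix_mult_def vec_eq_iff sum_negf)

lemma matrix_distrib_right: "(A + B) ** C = A ** C + B ** C"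
  by (simp add: matrix_matrix_mult_def vec_eq_iff algebra_simps sum.distrib)

lemma matrix_diff_left: "(A - B) ** C = A ** C - B ** C"
  by (simp add: matrix_matrix_mult_def vec_eq_iff algebra_simps sum_subtractf)

lemma matrix_diff_right: "A ** (B - C) = A ** B - A ** C"
  by (simp add: matrix_matrix_mult_def vec_eq_iff algebra_simps sum_subtractf)

end

lemmas matrix_ring_simps = matrix_add_ldistrib matrix_distrib_right matrix_diff_left
  matrix_diff_right matrix_uminus_left matrix_uminus_right matrix_mul_assoc

lemma additive_map_matrix:
  assumes "Modules.additive T"
  shows "Modules.additive (map_matrix T :: 'a::ab_group_add^'n^'m \<Rightarrow> 'b::ab_group_add^'n^'m)"
  using Modules.additive.add [OF assms] by unfold_locales (simp add: vec_eq_iff)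

lemma matrix_inv_cancel:
  fixes J :: "'a::comm_ring_1^'n^'n"
  assumes "invertible J"
  shows "J ** matrix_inv J = mat 1" "matrix_inv J ** J = mat 1"
  using someI_ex [OF assms [unfolded invertible_def]] by (simp_all add: matrix_inv_def)

text \<open>Covers total and Frechet derivatives alike, so that each matrix identity below can be
  used with both.\<close>

locale derivation = Modules.additive T for T :: "'a::comm_ring_1 \<Rightarrow> 'a" +
  assumes leibniz: "leibniz T"
begin

sublocale mat: additive "map_matrix T :: 'a^'n^'m \<Rightarrow> 'a^'n^'m"
  by (rule additive_map_matrix) unfold_locales

lemma mult: "T (a * b) = T a * b + a * T b"
  using leibniz by (simp add: leibniz_def)

lemma map_matrix_mult:
  fixes A B :: "'a^'n^'n"
  shows "map_matrix T (A ** B) = map_matrix T A ** B + A ** map_matrix T B"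
  by (simp add: vec_eq_iff matrix_matrix_mult_def sum mult sum.distrib)

lemma map_matrix_one: "map_matrix T (mat 1 :: 'a^'n^'n) = 0"
proof -
  have "T 1 = T 1 + T 1" using mult [of 1 1] by simp
  then have "T 1 = 0" by simp
  then show ?thesis by (simp add: vec_eq_iff mat_def zero)
qed

text \<open>Apply \<open>T\<close> to \<open>J^-1 J = 1\<close>, whose derivative is zero, and
  multiply by \<open>J^-1\<close> on the right.\<close>

lemma map_matrix_inv:
  fixes J :: "'a^'n^'n"
  assumes "invertible J"
  shows "map_matrix T (matrix_inv J) = - (matrix_inv J ** map_matrix T J ** matrix_inv J)"
proof -
  have "0 = map_matrix T (matrix_inv J ** J) ** matrix_inv J"
    by (simp add: matrix_inv_cancel [OF assms] map_matrix_one)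
  also have "\<dots> = map_matrix T (matrix_inv J) ** (J ** matrix_inv J)
      + matrix_inv J ** map_matrix T J ** matrix_inv J"
    by (simp add: map_matrix_mult matrix_ring_simps)
  also have "\<dots> = map_matrix T (matrix_inv J) + matrix_inv J ** map_matrix T J ** matrix_inv J"
    by (simp add: matrix_inv_cancel [OF assms])
  finally show ?thesis by (simp add: eq_neg_iff_add_eq_0)
qed

lemma map_matrix_mcomm:
  fixes A B :: "'a^'n^'n"
  shows "map_matrix T (mcomm A B) = mcomm (map_matrix T A) B + mcomm A (map_matrix T B)"
  by (simp add: mcomm_def mat.diff map_matrix_mult)

end

section \<open>Flatness of the pure-gauge connection\<close>

text \<open>With \<open>A = J^-1 S J\<close> and \<open>B = J^-1 T J\<close> this is zero curvature,
  \<open>T A - S B = [A, B]\<close>: the second derivatives of \<open>J\<close> agree, and the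
  derivatives of \<open>J^-1\<close> leave the commutator. Taking \<open>T = D_z\<close> gives
  flatness, taking \<open>T\<close> a Frechet derivative gives the linearized connecting
  relations.\<close>

lemma map_matrix_pure_gauge:
  fixes J :: "'a::comm_ring_1^'n^'n"
  assumes S: "derivation S" and T: "derivation T" and comm: "\<And>a. T (S a) = S (T a)"
    and J: "invertible J"
  shows "map_matrix T (matrix_inv J ** map_matrix S J) =
    cov S (matrix_inv J ** map_matrix S J) (matrix_inv J ** map_matrix T J)"
proof -
  have "map_matrix T (map_matrix S J) = map_matrix S (map_matrix T J)"
    by (simp add: vec_eq_iff comm)
  then show ?thesis
    by (simp add: cov_def mcomm_def derivation.map_matrix_mult [OF S] derivation.map_matrix_mult [OF T]
        derivation.map_matrix_inv [OF S J] derivation.map_matrix_inv [OF T J] matrix_ring_simps)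
qed

text \<open>The commutator of the two operators is the bracket with the curvature
  \<open>T A - S B - [A, B]\<close>, which \<open>flat\<close> makes zero.\<close>

lemma cov_commute:
  fixes M :: "'a::comm_ring_1^'n^'n"
  assumes S: "derivation S" and T: "derivation T" and comm: "\<And>a. T (S a) = S (T a)"
    and flat: "map_matrix T A = cov S A B"
  shows "cov T B (cov S A M) = cov S A (cov T B M)"
proof -
  interpret S: derivation S by (rule S)
  interpret T: derivation T by (rule T)
  have "map_matrix T (map_matrix S M) = map_matrix S (map_matrix T M)"
    by (simp add: vec_eq_iff comm)
  then show ?thesis
    by (simp add: cov_def S.mat.add T.mat.add S.map_matrix_mcomm T.map_matrix_mcomm
        flat [unfolded cov_def]) (simp add: mcomm_def matrix_ring_simps algebra_simps)
qed

section \<open>Complex linearity and the recursion system\<close>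

context diff_calculus
begin

lemma complex_linear_opD:
  assumes "complex_linear_op C T"
  shows "Modules.additive T" "T (cst C c * a) = cst C c * T a"
  using assms by (simp_all add: complex_linear_op_def Modules.additive_def)

lemma derivationI: "complex_linear_op C T \<Longrightarrow> leibniz T \<Longrightarrow> derivation T"
  by (simp add: derivation_def derivation_axioms_def complex_linear_opD)

lemmas derivation_D = derivationI [OF D_linear(1) D_leibniz(1)] derivationI [OF D_linear(2) D_leibniz(2)]
  derivationI [OF D_linear(3) D_leibniz(3)]

lemma vector_space_mscale: "vector_space (mscale C :: complex \<Rightarrow> 'a^'n^'n \<Rightarrow> 'a^'n^'n)"
  by unfold_locales (simp_all add: mscale_def vec_eq_iff cst_hom algebra_simps)

lemma map_matrix_mscale:
  "complex_linear_op C T \<Longrightarrow> map_matrix T (mscale C c M) = mscale C c (map_matrix T M)"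
  by (simp add: mscale_def vec_eq_iff complex_linear_opD)

lemma mscale_mult:
  fixes A B :: "'a^'n^'n"
  shows "A ** mscale C c B = mscale C c (A ** B)" "mscale C c A ** B = mscale C c (A ** B)"
  by (simp_all add: mscale_def vec_eq_iff matrix_matrix_mult_def sum_distrib_left mult_ac)

lemma cov_add: "Modules.additive T \<Longrightarrow> cov T A (M + N) = cov T A M + cov T A N"
  by (simp add: cov_def mcomm_def Modules.additive.add [OF additive_map_matrix] matrix_ring_simps)

lemma cov_minus: "Modules.additive T \<Longrightarrow> cov T A (- M) = - cov T A M"
  by (simp add: cov_def mcomm_def Modules.additive.minus [OF additive_map_matrix] matrix_ring_simps)

lemma cov_mscale:
  fixes A M :: "'a^'n^'n"
  assumes "complex_linear_op C T"
  shows "cov T A (mscale C c M) = mscale C c (cov T A M)"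
proof -
  interpret vector_space "mscale C :: complex \<Rightarrow> 'a^'n^'n \<Rightarrow> 'a^'n^'n" by (rule vector_space_mscale)
  show ?thesis
    by (simp add: cov_def mcomm_def map_matrix_mscale [OF assms] mscale_mult
        scale_right_distrib scale_right_diff_distrib)
qed

lemma recursion_system_add:
  assumes "recursion_system C J Q \<Phi>" "recursion_system C J Q' \<Phi>'"
  shows "recursion_system C J (Q + Q') (\<Phi> + \<Phi>')"
  using assms
  by (simp add: recursion_system_def Ahat_y_def Ahat_z_def matrix_add_ldistrib cov_add
      derivation.axioms(1) derivation_D Modules.additive.add [OF additive_map_matrix])

lemma recursion_system_mscale:
  fixes J :: "'a^'n^'n"
  assumes "recursion_system C J Q \<Phi>"
  shows "recursion_system C J (mscale C c Q) (mscale C c \<Phi>)"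
proof -
  interpret vector_space "mscale C :: complex \<Rightarrow> 'a^'n^'n \<Rightarrow> 'a^'n^'n" by (rule vector_space_mscale)
  show ?thesis
    using assms by (simp add: recursion_system_def Ahat_y_def Ahat_z_def mscale_mult cov_mscale
        D_linear map_matrix_mscale)
qed

text \<open>Two solutions sharing one component differ by a homogeneous solution in the other, which
  the normalization then forces to vanish.\<close>

lemma recursion_system_diff:
  fixes J :: "'a^'n^'n"
  assumes "recursion_system C J Q \<Phi>" "recursion_system C J Q' \<Phi>'"
  shows "recursion_system C J (Q - Q') (\<Phi> - \<Phi>')"
proof -
  interpret vector_space "mscale C :: complex \<Rightarrow> 'a^'n^'n \<Rightarrow> 'a^'n^'n" by (rule vector_space_mscale)
  show ?thesis
    using recursion_system_add [OF assms(1) recursion_system_mscale [OF assms(2), of "- 1"]] by simp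
qed

lemma map_matrix_D_commute:
  fixes M :: "'a^'n^'m"
  shows "map_matrix (D_yb C) (map_matrix (D_z C) M) = map_matrix (D_z C) (map_matrix (D_yb C) M)"
  by (simp add: vec_eq_iff D_commute)

text \<open>This is the compatibility condition of the system for \<open>\<Phi>\<close>: its
  \<open>z\<close> and \<open>yb\<close> derivatives commute.\<close>

lemma recursion_system_sdym3_characteristic:
  assumes "recursion_system C J Q \<Phi>"
  shows "sdym3_characteristic C J Q"
  using assms
  by (simp add: recursion_system_def sdym3_characteristic_def map_matrix_D_commute
      Modules.additive.minus [OF additive_map_matrix] derivation.axioms(1) derivation_D)

text \<open>Here the other unknown is eliminated: the system prescribes both covariant derivatives
  of \<open>J^-1 Q\<close>, and these commute.\<close>

lemma recursion_system_psdym3_characteristic: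
  fixes J X :: "'a^'n^'n"
  assumes sys: "recursion_system C J Q \<Phi>" and JX: "connected C J X" and J: "invertible J"
  shows "psdym3_characteristic C X \<Phi>"
proof -
  \<comment> \<open>\<open>a\<close> and \<open>b\<close> are read in two ways: as
    \<open>J^-1 J_y\<close> and \<open>J^-1 J_z\<close> they form a flat connection, as derivatives
    of \<open>X\<close> they satisfy \<open>yb_a\<close>.\<close>
  define a where "a = map_matrix (D_z C) X"
  define b where "b = - map_matrix (D_yb C) X"
  define M where "M = matrix_inv J ** Q"
  note ops = Ahat_eq_cov_potential [OF JX, folded a_def b_def]
  have conn: "matrix_inv J ** map_matrix (D_y C) J = a" "matrix_inv J ** map_matrix (D_z C) J = b"
    using JX by (simp_all add: connected_def a_def b_def)
  have sys: "map_matrix (D_z C) \<Phi> = cov (D_y C) a M" "map_matrix (D_yb C) \<Phi> = - cov (D_z C) b M"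
    using sys by (simp_all add: recursion_system_def ops M_def)
  have "cov (D_z C) b (cov (D_y C) a M) = cov (D_y C) a (cov (D_z C) b M)"
  proof (rule cov_commute [OF derivation_D(1,2) D_commute(1) [symmetric]])
    show "map_matrix (D_z C) a = cov (D_y C) a b"
      using map_matrix_pure_gauge [OF derivation_D(1,2) D_commute(1) [symmetric] J]
      by (simp add: conn)
  qed
  then have flat: "cov (D_z C) b (map_matrix (D_z C) \<Phi>) + cov (D_y C) a (map_matrix (D_yb C) \<Phi>) = 0"
    by (simp add: sys cov_minus derivation.axioms(1) derivation_D)
  have yb_a: "map_matrix (D_yb C) a = - map_matrix (D_z C) b"
    by (simp add: a_def b_def map_matrix_D_commute
        Modules.additive.minus [OF additive_map_matrix] derivation.axioms(1) derivation_D)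
  \<comment> \<open>When \<open>D_yb\<close> and \<open>D_z\<close> are moved inside the covariant
    derivatives, the extra terms \<open>[D_yb a, \<Phi>]\<close> and \<open>[D_z b, \<Phi>]\<close>
    cancel by \<open>yb_a\<close>.\<close>
  have "map_matrix (D_yb C) (map_matrix (D_y C) \<Phi>) = map_matrix (D_y C) (map_matrix (D_yb C) \<Phi>)"
    by (simp add: vec_eq_iff D_commute)
  then have "map_matrix (D_yb C) (cov (D_y C) a \<Phi>) + map_matrix (D_z C) (cov (D_z C) b \<Phi>) =
      cov (D_z C) b (map_matrix (D_z C) \<Phi>) + cov (D_y C) a (map_matrix (D_yb C) \<Phi>)"
    by (simp add: cov_def Modules.additive.add [OF additive_map_matrix] derivation.axioms(1) derivation_D
        derivation.map_matrix_mcomm yb_a) (simp add: mcomm_def matrix_ring_simps)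
  with flat show ?thesis
    by (simp add: psdym3_characteristic_def a_def b_def)
qed

subsection \<open>Frechet derivatives\<close>

lemma frechet_opD:
  assumes "frechet_op C \<Delta>"
  shows "derivation \<Delta>" "complex_linear_op C \<Delta>" "leibniz \<Delta>"
    "\<And>f. f \<in> indep C \<Longrightarrow> \<Delta> f = 0"
    "\<And>a. \<Delta> (D_y C a) = D_y C (\<Delta> a)" "\<And>a. \<Delta> (D_z C a) = D_z C (\<Delta> a)"
    "\<And>a. \<Delta> (D_yb C a) = D_yb C (\<Delta> a)" "\<And>a. \<Delta> (Dinv_z C a) = Dinv_z C (\<Delta> a)"
  using assms by (auto simp: frechet_op_def intro: derivationI)

lemmas frechet_op_add = Modules.additive.add [OF derivation.axioms(1) [OF frechet_opD(1)]]
lemmas frechet_op_diff = Modules.additive.diff [OF derivation.axioms(1) [OF frechet_opD(1)]]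

lemmas calculus_linear = complex_linear_opD(2) [OF D_linear(1)] complex_linear_opD(2) [OF D_linear(2)]
  complex_linear_opD(2) [OF D_linear(3)] complex_linear_opD(2) [OF Dinv_z_linear]

lemmas calculus_additive = complex_linear_opD(1) [OF D_linear(1)] complex_linear_opD(1) [OF D_linear(2)]
  complex_linear_opD(1) [OF D_linear(3)] complex_linear_opD(1) [OF Dinv_z_linear]

lemma frechet_op_sum:
  assumes "frechet_op C \<Delta>" "frechet_op C \<Delta>'"
  shows "frechet_op C (\<lambda>a. \<Delta> a + \<Delta>' a)"
  using frechet_opD [OF assms(1)] frechet_opD [OF assms(2)] frechet_op_add [OF assms(1)] frechet_op_add [OF assms(2)]
  by (simp add: frechet_op_def complex_linear_op_def leibniz_def algebra_simps
      calculus_additive [THEN Modules.additive.add])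

lemma frechet_op_mult_cst:
  assumes "frechet_op C \<Delta>"
  shows "frechet_op C (\<lambda>a. cst C c * \<Delta> a)"
  using frechet_opD [OF assms] frechet_op_add [OF assms]
  by (simp add: frechet_op_def complex_linear_op_def leibniz_def distrib_left mult.assoc
      mult.left_commute calculus_linear)

text \<open>In the Leibniz rule the mixed products of first derivatives occur in both orders of
  composition and cancel.\<close>

lemma frechet_op_commutator:
  assumes "frechet_op C \<Delta>" "frechet_op C \<Delta>'"
  shows "frechet_op C (op_comm \<Delta> \<Delta>')"
  using frechet_opD [OF assms(1)] frechet_opD [OF assms(2)] frechet_op_add [OF assms(1)] frechet_op_add [OF assms(2)]
    Modules.additive.zero [OF derivation.axioms(1) [OF frechet_opD(1) [OF assms(1)]]]
    Modules.additive.zero [OF derivation.axioms(1) [OF frechet_opD(1) [OF assms(2)]]]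
  by (simp add: frechet_op_def op_comm_def complex_linear_op_def leibniz_def algebra_simps
      calculus_additive [THEN Modules.additive.diff])

lemma map_matrix_op_comm:
  "map_matrix (op_comm S T) M = map_matrix S (map_matrix T M) - map_matrix T (map_matrix S M)"
  by (simp add: vec_eq_iff op_comm_def)

lemma frechet_op_recursion_system:
  fixes J X :: "'a^'n^'n"
  assumes \<Delta>: "frechet_op C \<Delta>" and JX: "connected C J X" and J: "invertible J"
  shows "recursion_system C J (map_matrix \<Delta> J) (map_matrix \<Delta> X)"
proof -
  note d = frechet_opD [OF \<Delta>]
  have "map_matrix \<Delta> (map_matrix (D_z C) X) = map_matrix (D_z C) (map_matrix \<Delta> X)"
    "map_matrix \<Delta> (- map_matrix (D_yb C) X) = - map_matrix (D_yb C) (map_matrix \<Delta> X)"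
    by (simp_all add: vec_eq_iff d Modules.additive.minus [OF derivation.axioms(1) [OF d(1)]])
  then show ?thesis
    using map_matrix_pure_gauge [OF derivation_D(1) d(1) d(5) J]
      map_matrix_pure_gauge [OF derivation_D(2) d(1) d(6) J] JX
    by (simp add: recursion_system_def Ahat_y_def Ahat_z_def connected_def)
qed

end

subsection \<open>The isomorphism\<close>

context normalized_sdym3
begin

abbreviation symQ where "symQ \<equiv> sdym3_symmetries C J NQ"
abbreviation symP where "symP \<equiv> psdym3_symmetries C X NP"

text \<open>Names the description occurring in the brackets; on \<open>symQ\<close> it denotes an
  actual operator by \<open>frechet_unique\<close>.\<close>

definition frechet :: "'a^'n^'n \<Rightarrow> 'a \<Rightarrow> 'a"
  where "frechet Q = (THE \<Delta>. frechet_of C J X Q (I_map C J Q) \<Delta>)"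

sublocale V: vector_space "mscale C :: complex \<Rightarrow> 'a^'n^'n \<Rightarrow> 'a^'n^'n"
  by (rule vector_space_mscale)

lemma frechet_of_frechet: "Q \<in> symQ \<Longrightarrow> frechet_of C J X Q (I_map C J Q) (frechet Q)"
  unfolding frechet_def using theI' [OF frechet_unique] .

lemma frechet_eqI:
  "Q \<in> symQ \<Longrightarrow> frechet_of C J X Q (I_map C J Q) \<Delta> \<Longrightarrow> frechet Q = \<Delta>"
  using frechet_unique frechet_of_frechet by blast

lemma frechetD:
  assumes "Q \<in> symQ"
  shows "frechet_op C (frechet Q)" "map_matrix (frechet Q) J = Q"
    "map_matrix (frechet Q) X = I_map C J Q"
  using frechet_of_frechet [OF assms] by (simp_all add: frechet_of_def)

lemma symQ_system:
  assumes "Q \<in> symQ"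
  shows "I_map C J Q \<in> NP" "recursion_system C J Q (I_map C J Q)"
  using assms solvable_\<Phi> by (simp_all add: sdym3_symmetries_def I_map_def)

lemma symQI: "Q \<in> NQ \<Longrightarrow> recursion_system C J Q \<Phi> \<Longrightarrow> Q \<in> symQ"
  using recursion_system_sdym3_characteristic by (simp add: sdym3_symmetries_def)

lemma symQ_subset: "Q \<in> symQ \<Longrightarrow> Q \<in> NQ"
  by (simp add: sdym3_symmetries_def)

lemma symQ_add: "Q \<in> symQ \<Longrightarrow> Q' \<in> symQ \<Longrightarrow> Q + Q' \<in> symQ"
  by (rule symQI [OF V.subspace_add [OF NQ_subspace]])
    (auto intro: symQ_subset recursion_system_add symQ_system)

lemma symQ_mscale: "Q \<in> symQ \<Longrightarrow> mscale C c Q \<in> symQ"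
  by (rule symQI [OF V.subspace_scale [OF NQ_subspace]])
    (auto intro: symQ_subset recursion_system_mscale symQ_system)

lemma subspace_symQ: "V.subspace symQ"
proof (rule V.subspaceI)
  \<comment> \<open>The zero operator is a Frechet operator, so the zero pair solves the
    system.\<close>
  have "recursion_system C J (map_matrix (\<lambda>_. 0) J) (map_matrix (\<lambda>_. 0) X)"
    by (rule frechet_op_recursion_system [OF _ J_X_connected J_SL(1)])
      (simp add: frechet_op_def complex_linear_op_def leibniz_def
        calculus_additive [THEN Modules.additive.zero])
  moreover have "map_matrix (\<lambda>_. 0) J = 0" by (simp add: vec_eq_iff)
  ultimately show "0 \<in> symQ"
    using symQI [OF V.subspace_0 [OF NQ_subspace]] by metis
qed (auto intro: symQ_add symQ_mscale)

lemma I_map_add: "I_map C J (Q + Q') = I_map C J Q + I_map C J Q'"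
  by (simp add: I_map_def Rhat_def Ahat_y_def matrix_add_ldistrib cov_add calculus_additive
      Modules.additive.add [OF additive_map_matrix])

lemma I_map_mscale: "I_map C J (mscale C c Q) = mscale C c (I_map C J Q)"
  by (simp add: I_map_def Rhat_def Ahat_y_def mscale_mult cov_mscale D_linear Dinv_z_linear
      map_matrix_mscale)

lemma bij_betw_I_map: "bij_betw (I_map C J) symQ symP"
  unfolding bij_betw_def
proof
  show "inj_on (I_map C J) symQ"
  proof (rule inj_onI)
    fix Q Q' assume Q: "Q \<in> symQ" "Q' \<in> symQ" and eq: "I_map C J Q = I_map C J Q'"
    have "recursion_system C J (Q - Q') 0"
      using recursion_system_diff [OF Q [THEN symQ_system(2)]] eq by simp
    moreover have "Q - Q' \<in> NQ"
      using Q by (auto intro: V.subspace_diff [OF NQ_subspace] symQ_subset)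
    ultimately show "Q = Q'" using homogeneous_Q by force
  qed
  show "I_map C J ` symQ = symP"
  proof (intro equalityI subsetI)
    fix \<Phi> assume "\<Phi> \<in> I_map C J ` symQ"
    then show "\<Phi> \<in> symP"
      using symQ_system recursion_system_psdym3_characteristic [OF _ J_X_connected J_SL(1)]
      by (auto simp: psdym3_symmetries_def)
  next
    fix \<Phi> assume \<Phi>: "\<Phi> \<in> symP"
    then obtain Q where "Q \<in> NQ" and sys: "recursion_system C J Q \<Phi>"
      using solvable_Q by (auto simp: psdym3_symmetries_def)
    then have Q: "Q \<in> symQ" by (rule symQI)
    \<comment> \<open>\<open>Q\<close> solves the system both with \<open>\<Phi>\<close> and with
      the solution that \<open>Rhat\<close> selects, so their difference is homogeneous.\<close>
    have "recursion_system C J 0 (\<Phi> - I_map C J Q)"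
      using recursion_system_diff [OF sys symQ_system(2) [OF Q]] by simp
    moreover have "\<Phi> - I_map C J Q \<in> NP"
      using \<Phi> symQ_system(1) [OF Q]
      by (auto simp: psdym3_symmetries_def intro: V.subspace_diff [OF NP_subspace])
    ultimately have "\<Phi> = I_map C J Q" using homogeneous_\<Phi> by force
    with Q show "\<Phi> \<in> I_map C J ` symQ" by blast
  qed
qed

section \<open>Brackets as commutators of Frechet derivatives\<close>

lemma sdym3_bracket_eq:
  "sdym3_bracket C J X Q Q' = map_matrix (frechet Q) Q' - map_matrix (frechet Q') Q"
  by (simp add: sdym3_bracket_def frechet_def)

lemma sdym3_bracket_commutator:
  assumes "Q \<in> symQ" "Q' \<in> symQ"
  shows "sdym3_bracket C J X Q Q' = map_matrix (op_comm (frechet Q) (frechet Q')) J"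
  using assms by (simp add: sdym3_bracket_eq map_matrix_op_comm frechetD)

text \<open>By injectivity \<open>inv_into\<close> recovers \<open>Q\<close> from its image, so both
  brackets use the same operators, and these send \<open>X\<close> to the images.\<close>

lemma psdym3_bracket_commutator:
  assumes "Q \<in> symQ" "Q' \<in> symQ"
  shows "psdym3_bracket C J X NQ (I_map C J Q) (I_map C J Q') =
    map_matrix (op_comm (frechet Q) (frechet Q')) X"
  using assms bij_betw_imp_inj_on [OF bij_betw_I_map]
  by (simp add: psdym3_bracket_def inv_into_f_f map_matrix_op_comm frechetD flip: frechet_def)

text \<open>The recursion system fixes \<open>W X\<close> only up to homogeneous terms; the
  ambiguity is removed by exhibiting \<open>W X\<close> as a value of \<open>Dinv_z\<close>.\<close>

lemma commutator_symmetry: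
  assumes Q: "Q \<in> symQ" "Q' \<in> symQ"
  defines "W \<equiv> op_comm (frechet Q) (frechet Q')"
  shows "map_matrix W J \<in> symQ" "map_matrix W X = I_map C J (map_matrix W J)"
    "frechet (map_matrix W J) = W"
proof -
  note ops = frechetD(1) [OF Q(1)] frechetD(1) [OF Q(2)]
  have W: "frechet_op C W"
    unfolding W_def by (rule frechet_op_commutator [OF ops])
  have sys: "recursion_system C J (map_matrix W J) (map_matrix W X)"
    by (rule frechet_op_recursion_system [OF W J_X_connected J_SL(1)])
  have "map_matrix W J \<in> NQ"
    unfolding W_def using bracket_normalized Q frechet_of_frechet by blast
  then show sym: "map_matrix W J \<in> symQ"
    using sys by (rule symQI)
  define K where "K = (\<lambda>Q. Ahat_y C J (matrix_inv J ** Q))"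
  have I: "I_map C J Q = map_matrix (Dinv_z C) (K Q)" for Q
    by (simp add: I_map_def Rhat_def K_def)
  have move: "map_matrix \<Delta> (map_matrix (Dinv_z C) M) = map_matrix (Dinv_z C) (map_matrix \<Delta> M)"
    if "frechet_op C \<Delta>" for \<Delta> and M :: "'a^'n^'n"
    using that by (simp add: vec_eq_iff frechet_opD)
  \<comment> \<open>Frechet operators commute with \<open>Dinv_z\<close>, so the integration can be
    pulled out of the commutator applied to \<open>X\<close>; \<open>N\<close> is the
    integrand.\<close>
  define N where "N = map_matrix (frechet Q) (K Q') - map_matrix (frechet Q') (K Q)"
  have WX: "map_matrix W X = map_matrix (Dinv_z C) N"
    by (simp add: W_def N_def map_matrix_op_comm frechetD Q I move
        Modules.additive.diff [OF additive_map_matrix] calculus_additive)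
  \<comment> \<open>Since \<open>D_z\<close> undoes \<open>Dinv_z\<close>, the system identifies
    \<open>N\<close> with the integrand that defines \<open>I_map\<close> at
    \<open>W J\<close>.\<close>
  have "K (map_matrix W J) = map_matrix (D_z C) (map_matrix W X)"
    using sys by (simp add: recursion_system_def K_def)
  also have "\<dots> = N"
    by (simp add: WX vec_eq_iff D_z_Dinv_z)
  finally show "map_matrix W X = I_map C J (map_matrix W J)"
    by (simp add: I WX)
  then show "frechet (map_matrix W J) = W"
    using sym W by (intro frechet_eqI) (simp_all add: frechet_of_def)
qed

section \<open>Bilinearity and the Lie algebra laws\<close>

text \<open>The sum of the operators sends \<open>J\<close> and \<open>X\<close> to the required
  values, so uniqueness identifies it.\<close>

lemma frechet_add:
  assumes "Q \<in> symQ" "Q' \<in> symQ"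
  shows "frechet (Q + Q') = (\<lambda>a. frechet Q a + frechet Q' a)"
proof (rule frechet_eqI [OF symQ_add [OF assms]])
  have sum: "map_matrix (\<lambda>a. frechet Q a + frechet Q' a) M = map_matrix (frechet Q) M + map_matrix (frechet Q') M"
    for M :: "'a^'n^'n" by (simp add: vec_eq_iff)
  show "frechet_of C J X (Q + Q') (I_map C J (Q + Q')) (\<lambda>a. frechet Q a + frechet Q' a)"
    using assms by (simp add: frechet_of_def sum frechetD frechet_op_sum I_map_add)
qed

lemma frechet_mscale:
  assumes "Q \<in> symQ"
  shows "frechet (mscale C c Q) = (\<lambda>a. cst C c * frechet Q a)"
proof (rule frechet_eqI [OF symQ_mscale [OF assms]])
  have scale: "map_matrix (\<lambda>a. cst C c * frechet Q a) M = mscale C c (map_matrix (frechet Q) M)"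
    for M :: "'a^'n^'n" by (simp add: vec_eq_iff mscale_def)
  show "frechet_of C J X (mscale C c Q) (I_map C J (mscale C c Q)) (\<lambda>a. cst C c * frechet Q a)"
    using assms by (simp add: frechet_of_def scale frechetD frechet_op_mult_cst I_map_mscale)
qed

lemma sdym3_bracket_skew: "sdym3_bracket C J X Q Q' = - sdym3_bracket C J X Q' Q"
  by (simp add: sdym3_bracket_eq)

lemma sdym3_bracket_add_left:
  assumes "Q \<in> symQ" "Q' \<in> symQ" "R \<in> symQ"
  shows "sdym3_bracket C J X (Q + Q') R = sdym3_bracket C J X Q R + sdym3_bracket C J X Q' R"
  using assms
  by (simp add: sdym3_bracket_eq frechet_add vec_eq_iff frechet_op_add [OF frechetD(1)])

lemma sdym3_bracket_mscale_left:
  assumes "Q \<in> symQ" "R \<in> symQ"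
  shows "sdym3_bracket C J X (mscale C c Q) R = mscale C c (sdym3_bracket C J X Q R)"
  using assms
  by (simp add: sdym3_bracket_eq frechet_mscale)
    (simp add: vec_eq_iff mscale_def right_diff_distrib
      complex_linear_opD(2) [OF frechet_opD(2) [OF frechetD(1)]])

lemma sdym3_bracket_jacobi:
  assumes Q: "u \<in> symQ" "v \<in> symQ" "w \<in> symQ"
  defines "br \<equiv> sdym3_bracket C J X"
  shows "br u (br v w) + br v (br w u) + br w (br u v) = 0"
proof -
  \<comment> \<open>The Frechet derivative of the inner bracket is itself a commutator, so the claim
    becomes the Jacobi identity for operators, evaluated at \<open>J\<close>.\<close>
  have nested: "br u (br v w) = map_matrix (op_comm (frechet u) (op_comm (frechet v) (frechet w))) J"
    if "u \<in> symQ" "v \<in> symQ" "w \<in> symQ" for u v w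
    using that by (simp add: br_def sdym3_bracket_commutator commutator_symmetry)
  show ?thesis
    using Q by (simp add: nested vec_eq_iff op_comm_def frechet_op_diff [OF frechetD(1)])
qed

lemma lie_algebra_symQ: "lie_algebra (mscale C) symQ (sdym3_bracket C J X)"
proof
  show "V.subspace symQ" by (rule subspace_symQ)
  show "sdym3_bracket C J X u (v + w) = sdym3_bracket C J X u v + sdym3_bracket C J X u w"
    if "u \<in> symQ" "v \<in> symQ" "w \<in> symQ" for u v w
    using that sdym3_bracket_add_left [of v w u] by (simp add: sdym3_bracket_skew [of u])
  show "sdym3_bracket C J X u (mscale C c v) = mscale C c (sdym3_bracket C J X u v)"
    if "u \<in> symQ" "v \<in> symQ" for u v c
    using that sdym3_bracket_mscale_left [of v u c] by (simp add: sdym3_bracket_skew [of u])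
  show "sdym3_bracket C J X u u = 0" for u
    by (simp add: sdym3_bracket_eq)
  show "sdym3_bracket C J X u v \<in> symQ" if "u \<in> symQ" "v \<in> symQ" for u v
    using that by (simp add: sdym3_bracket_commutator commutator_symmetry(1))
qed (fact sdym3_bracket_add_left sdym3_bracket_mscale_left sdym3_bracket_jacobi)+

lemma lie_algebra_iso_I_map:
  "lie_algebra_iso (mscale C) symQ (sdym3_bracket C J X)
    (mscale C) symP (psdym3_bracket C J X NQ) (I_map C J)"
  by (rule lie_algebra_iso_transport [OF lie_algebra_symQ vector_space_mscale bij_betw_I_map])
    (simp_all add: I_map_add I_map_mscale sdym3_bracket_commutator psdym3_bracket_commutator
      commutator_symmetry(2))

end

theorem proposition1:
  fixes C :: "'a::comm_ring_1 diff_calc"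
    and J X :: "'a^'n^'n"
    and NQ NP :: "('a^'n^'n) set"
  assumes "normalized_sdym3 C J X NQ NP"
  shows "lie_algebra_iso
      (mscale C) (sdym3_symmetries C J NQ) (sdym3_bracket C J X)
      (mscale C) (psdym3_symmetries C X NP) (psdym3_bracket C J X NQ)
      (I_map C J) \<and>
    (\<forall>Q\<^sub>i Q\<^sub>j \<Phi>\<^sub>i \<Phi>\<^sub>j \<Delta>\<^sub>i \<Delta>\<^sub>j.
      Q\<^sub>i \<in> sdym3_symmetries C J NQ \<and> Q\<^sub>j \<in> sdym3_symmetries C J NQ \<and>
      \<Phi>\<^sub>i = I_map C J Q\<^sub>i \<and> \<Phi>\<^sub>j = I_map C J Q\<^sub>j \<and>
      frechet_of C J X Q\<^sub>i \<Phi>\<^sub>i \<Delta>\<^sub>i \<and> frechet_of C J X Q\<^sub>j \<Phi>\<^sub>j \<Delta>\<^sub>j \<longrightarrow>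
        sdym3_bracket C J X Q\<^sub>i Q\<^sub>j = map_matrix (op_comm \<Delta>\<^sub>i \<Delta>\<^sub>j) J \<and>
        psdym3_bracket C J X NQ \<Phi>\<^sub>i \<Phi>\<^sub>j = map_matrix (op_comm \<Delta>\<^sub>i \<Delta>\<^sub>j) X \<and>
        map_matrix (op_comm \<Delta>\<^sub>i \<Delta>\<^sub>j) X = I_map C J (map_matrix (op_comm \<Delta>\<^sub>i \<Delta>\<^sub>j) J) \<and>
        I_map C J (map_matrix (op_comm \<Delta>\<^sub>i \<Delta>\<^sub>j) J) =
          Rhat C J (matrix_inv J ** map_matrix (op_comm \<Delta>\<^sub>i \<Delta>\<^sub>j) J))"
proof (intro conjI allI impI; (elim conjE)?)
  interpret normalized_sdym3 C J X NQ NP by (rule assms)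
  show "lie_algebra_iso
      (mscale C) (sdym3_symmetries C J NQ) (sdym3_bracket C J X)
      (mscale C) (psdym3_symmetries C X NP) (psdym3_bracket C J X NQ)
      (I_map C J)"
    by (rule lie_algebra_iso_I_map)
  fix Q Q' \<Phi> \<Phi>' \<Delta> \<Delta>'
  assume Q: "Q \<in> symQ" "Q' \<in> symQ" and \<Phi>: "\<Phi> = I_map C J Q" "\<Phi>' = I_map C J Q'"
    and "frechet_of C J X Q \<Phi> \<Delta>" "frechet_of C J X Q' \<Phi>' \<Delta>'"
  \<comment> \<open>By uniqueness, arbitrary Frechet derivatives belonging to the two pairs are the
    ones chosen in the brackets.\<close>
  then have [simp]: "\<Delta> = frechet Q" "\<Delta>' = frechet Q'"
    by (simp_all add: frechet_eqI)
  show "sdym3_bracket C J X Q Q' = map_matrix (op_comm \<Delta> \<Delta>') J"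
    using Q by (simp add: sdym3_bracket_commutator)
  show "psdym3_bracket C J X NQ \<Phi> \<Phi>' = map_matrix (op_comm \<Delta> \<Delta>') X"
    using Q by (simp add: \<Phi> psdym3_bracket_commutator)
  show "map_matrix (op_comm \<Delta> \<Delta>') X = I_map C J (map_matrix (op_comm \<Delta> \<Delta>') J)"
    using commutator_symmetry(2) [OF Q] by simp
  show "I_map C J (map_matrix (op_comm \<Delta> \<Delta>') J) =
      Rhat C J (matrix_inv J ** map_matrix (op_comm \<Delta> \<Delta>') J)"
    by (simp add: I_map_def)
qed

end
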